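(* Let $\delta=\delta(n)$ be a positive-integer-valued function with $\delta(n)\to\infty$ as $n\to\infty$, and let $M\geq 0$. Then there exists a constant $c>0$ such that for every $n$ for which $\delta+1$ divides $n$, and for every set of edges $F\subset E(H_\delta)$ such that $H_\delta\setminus F$ admits an identifying code and $$\gamma^{\mathrm{ID}}(H_\delta\setminus F)\leq M\,\frac{n\log\delta}{\delta},$$ we have $$|F|\geq c\,n\log\delta .$$
   Context: Graphs are finite, simple and undirected; $\log$ is the natural logarithm. $H_\delta$ denotes the graph on $n$ vertices that is the disjoint union of $n/(\delta+1)$ cliques, each of order $\delta+1$ (assuming $\delta+1$ divides $n$). $H_\delta\setminus F$ is the spanning subgraph obtained by deleting the edges in $F$. For a vertex $v$, $N[v]=N(v)\cup\{v\}$ is its closed neighborhood. A set $C\subseteq V(G)$ is an identifying code of $G$ if it is dominating ($N[v]\cap C\neq\emptyset$ for every vertex $v$) and separating ($N[u]\cap C\neq N[v]\cap C$ for every pair of distinct vertices $u,v$). If $G$ admits an identifying code (equivalently, has no two distinct vertices with equal closed neighborhoods), $\gamma^{\mathrm{ID}}(G)$ denotes the minimum size of an identifying code of $G$. *)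

theory Defs
  imports Complex_Main
begin

type_synonym 'a graph = "'a set \<times> 'a set set"

abbreviation verts :: "'a graph \<Rightarrow> 'a set" where
  "verts G \<equiv> fst G"

abbreviation edges :: "'a graph \<Rightarrow> 'a set set" where
  "edges G \<equiv> snd G"

definition finite_simple_graph :: "'a graph \<Rightarrow> bool" where
  "finite_simple_graph G \<longleftrightarrow>
     finite (verts G) \<and> (\<forall>e\<in>edges G. e \<subseteq> verts G \<and> card e = 2)"

definition neighborhood :: "'a graph \<Rightarrow> 'a \<Rightarrow> 'a set" where
  "neighborhood G v = {u \<in> verts G. {u, v} \<in> edges G}"

definition closed_neighborhood :: "'a graph \<Rightarrow> 'a \<Rightarrow> 'a set" where
  "closed_neighborhood G v = neighborhood G v \<union> {v}"

definition dominating :: "'a graph \<Rightarrow> 'a set \<Rightarrow> bool" where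
  "dominating G C \<longleftrightarrow> (\<forall>v\<in>verts G. closed_neighborhood G v \<inter> C \<noteq> {})"

definition separating :: "'a graph \<Rightarrow> 'a set \<Rightarrow> bool" where
  "separating G C \<longleftrightarrow>
     (\<forall>u\<in>verts G. \<forall>v\<in>verts G. u \<noteq> v \<longrightarrow>
        closed_neighborhood G u \<inter> C \<noteq> closed_neighborhood G v \<inter> C)"

definition identifying_code :: "'a graph \<Rightarrow> 'a set \<Rightarrow> bool" where
  "identifying_code G C \<longleftrightarrow> C \<subseteq> verts G \<and> dominating G C \<and> separating G C"

definition admits_identifying_code :: "'a graph \<Rightarrow> bool" where
  "admits_identifying_code G \<longleftrightarrow> (\<exists>C. identifying_code G C)"

text \<open>Only meaningful for graphs that admit an identifying code.\<close>

definition gamma_ID :: "'a graph \<Rightarrow> nat" where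
  "gamma_ID G = (LEAST k. \<exists>C. identifying_code G C \<and> card C = k)"

definition delete_edges :: "'a graph \<Rightarrow> 'a set set \<Rightarrow> 'a graph" where
  "delete_edges G F = (verts G, edges G - F)"

text \<open>The vertex \<open>(i, a)\<close> is the \<open>a\<close>-th vertex of the \<open>i\<close>-th clique. The graph has
  \<open>n\<close> vertices only if \<open>d + 1\<close> divides \<open>n\<close>.\<close>

definition clique_union :: "nat \<Rightarrow> nat \<Rightarrow> (nat \<times> nat) graph" where
  "clique_union n d =
     ({..<n div (d + 1)} \<times> {..<d + 1},
      {{(i, a), (i, b)} | i a b. i < n div (d + 1) \<and> a < d + 1 \<and> b < d + 1 \<and> a \<noteq> b})"

lemma finite_simple_graph_clique_union: "finite_simple_graph (clique_union n d)"
  by (auto simp: finite_simple_graph_def clique_union_def)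

lemma card_verts_clique_union: "(d + 1) dvd n \<Longrightarrow> card (verts (clique_union n d)) = n"
  unfolding clique_union_def by (simp add: card_cartesian_product del: mult_Suc_right)

lemma finite_simple_graph_delete_edges:
  "finite_simple_graph G \<Longrightarrow> finite_simple_graph (delete_edges G F)"
  by (auto simp: finite_simple_graph_def delete_edges_def)

lemma admits_identifying_code_iff:
  assumes "finite_simple_graph G"
  shows "admits_identifying_code G \<longleftrightarrow> inj_on (closed_neighborhood G) (verts G)"
proof -
  have "closed_neighborhood G v \<inter> verts G = closed_neighborhood G v" if "v \<in> verts G" for v
    using that by (auto simp: closed_neighborhood_def neighborhood_def)
  then have "identifying_code G (verts G)" if "inj_on (closed_neighborhood G) (verts G)"
    using that unfolding identifying_code_def dominating_def separating_def inj_on_def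
    by (auto simp: closed_neighborhood_def)
  then show ?thesis
    unfolding admits_identifying_code_def inj_on_def
    by (auto simp: identifying_code_def separating_def) (metis)
qed

end

theory Submission
  imports Defs
begin

text \<open>Inside one clique of order \<open>D = d + 1\<close> let \<open>k\<close> be the number of code vertices and let
  \<open>S v\<close> be the set of code vertices whose edge to \<open>v\<close> is deleted. Separation makes the sets \<open>S v\<close>
  distinct, so \<open>\<Sum>v. x ^ card (S v) \<le> (1 + x) ^ k \<le> exp (x * k)\<close>, and the tangent
  inequality for \<open>exp\<close> turns this into
  \<open>D * (ln D - x * k) \<le> ln (1 / x) * (\<Sum>v. card (S v))\<close>. This bound is linear in \<open>k\<close>, so summing it
  over all cliques involves only the size of the code, while the sum of all \<open>card (S v)\<close> is at most
  \<open>2 * card F\<close>. A small \<open>x\<close> depending only on \<open>M\<close> absorbs the code term.\<close>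

text \<open>Each element of \<open>C\<close> is either left out, contributing a factor 1, or taken,
  contributing a factor \<open>x\<close>. This is the generating function of the subsets of
  \<open>C\<close> by size.\<close>

lemma sum_power_card_Pow:
  fixes x :: "'b::comm_semiring_1"
  assumes "finite C"
  shows "(\<Sum>S\<in>Pow C. x ^ card S) = (1 + x) ^ card C"
  using assms
proof (induction C rule: finite_induct)
  case empty
  then show ?case by simp
next
  case (insert a C)
  have inj: "inj_on (insert a) (Pow C)"
    using insert.hyps(2) by (auto simp: inj_on_def)
  have "(\<Sum>S\<in>Pow (insert a C). x ^ card S)
      = (\<Sum>S\<in>Pow C. x ^ card S) + (\<Sum>S\<in>insert a ` Pow C. x ^ card S)"
    unfolding Pow_insert using insert.hyps by (intro sum.union_disjoint) auto
  also have "(\<Sum>S\<in>insert a ` Pow C. x ^ card S) = (\<Sum>S\<in>Pow C. x ^ card (insert a S))"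
    using inj by (simp add: sum.reindex)
  also have "\<dots> = (\<Sum>S\<in>Pow C. x * x ^ card S)"
  proof (rule sum.cong)
    fix S assume "S \<in> Pow C"
    then have "finite S" "a \<notin> S"
      using insert.hyps finite_subset by auto
    then show "x ^ card (insert a S) = x * x ^ card S" by simp
  qed simp
  finally show ?case
    using insert by (simp add: sum_distrib_left [symmetric] distrib_right)
qed

text \<open>Small subsets of \<open>C\<close> are few, so distinct sets \<open>f v\<close> cannot
  all be small. Convexity of \<open>exp\<close> turns the upper bound on the mean of the weights
  \<open>x ^ card (f v)\<close> into a lower bound on the mean of
  \<open>ln (1 / x) * card (f v)\<close>.\<close>

lemma inj_on_subsets_sum_card_ge:
  fixes x :: real
  assumes "finite C" "f ` A \<subseteq> Pow C" "inj_on f A" "A \<noteq> {}" "0 < x"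
  shows "card A * (ln (card A) - x * card C) \<le> ln (1 / x) * (\<Sum>v\<in>A. real (card (f v)))"
proof -
  define L where "L = ln (1 / x)"
  \<comment> \<open>\<open>exp a\<close> is the upper bound \<open>exp (x * card C) / card A\<close>
    for the mean weight. After division by it the weights sum to at most \<open>card A\<close>,
    which cancels the constant terms 1 of the tangents.\<close>
  define a where "a = x * card C - ln (card A)"
  have fin: "finite A"
    using assms(1-3) by (meson finite_Pow_iff finite_imageD finite_subset)
  have pos: "real (card A) > 0"
    using fin assms(4) by (simp add: card_gt_0_iff)
  have x_eq: "x = exp (- L)"
    using assms(5) by (simp add: L_def ln_div)
  have "(\<Sum>v\<in>A. exp (- L * card (f v))) = (\<Sum>v\<in>A. x ^ card (f v))"
    by (simp add: x_eq exp_of_nat_mult [symmetric] mult.commute)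
  also have "\<dots> = (\<Sum>S\<in>f ` A. x ^ card S)"
    using assms(3) by (simp add: sum.reindex)
  also have "\<dots> \<le> (\<Sum>S\<in>Pow C. x ^ card S)"
    using assms by (intro sum_mono2) auto
  also have "\<dots> = (1 + x) ^ card C"
    using assms(1) by (rule sum_power_card_Pow)
  also have "\<dots> \<le> exp x ^ card C"
    using assms(5) by (intro power_mono exp_ge_add_one_self) auto
  also have "\<dots> = exp a * card A"
    using pos by (simp add: a_def exp_diff exp_of_nat_mult [symmetric] mult.commute)
  finally have le: "(\<Sum>v\<in>A. exp (- L * card (f v))) \<le> exp a * card A" .
  have "card A * (1 - a) - L * (\<Sum>v\<in>A. real (card (f v))) = (\<Sum>v\<in>A. 1 + (- L * card (f v) - a))"
    by (simp add: sum.distrib sum_subtractf sum_negf sum_distrib_left algebra_simps)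
  also have "\<dots> \<le> (\<Sum>v\<in>A. exp (- L * card (f v) - a))"
    by (intro sum_mono exp_ge_add_one_self)
  also have "\<dots> = (\<Sum>v\<in>A. exp (- L * card (f v))) / exp a"
    by (simp add: exp_diff sum_divide_distrib)
  also have "\<dots> \<le> card A"
    using le by (simp add: divide_le_eq mult.commute)
  finally show ?thesis
    by (simp add: L_def a_def algebra_simps)
qed

text \<open>Double counting of incidences: \<open>c\<close> determines the edge
  \<open>{c, v}\<close> at \<open>v\<close>, and an edge has at most two ends in
  \<open>V\<close>.\<close>

lemma sum_card_incident_le:
  assumes "finite V" "finite F" "\<And>e. e \<in> F \<Longrightarrow> card e = 2"
  shows "(\<Sum>v\<in>V. card {c. {c, v} \<in> F}) \<le> 2 * card F"
proof -
  have "(\<Sum>v\<in>V. card {c. {c, v} \<in> F}) \<le> (\<Sum>v\<in>V. card {e \<in> F. v \<in> e})"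
  proof (intro sum_mono)
    fix v
    have "inj_on (\<lambda>c. {c, v}) {c. {c, v} \<in> F}"
      by (auto simp: inj_on_def doubleton_eq_iff)
    then show "card {c. {c, v} \<in> F} \<le> card {e \<in> F. v \<in> e}"
      using assms(2) by (intro card_inj_on_le [where f = "\<lambda>c. {c, v}"]) auto
  qed
  also have "\<dots> = (\<Sum>e\<in>F. card {v \<in> V. v \<in> e})"
    using assms(1,2) by (rule sum_multicount_gen) simp
  also have "\<dots> \<le> (\<Sum>e\<in>F. 2)"
  proof (intro sum_mono)
    fix e assume "e \<in> F"
    then have "card e = 2" by (rule assms(3))
    moreover from this have "finite e" by (intro card_ge_0_finite) simp
    then have "card {v \<in> V. v \<in> e} \<le> card e" by (intro card_mono) auto
    ultimately show "card {v \<in> V. v \<in> e} \<le> 2" by simp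
  qed
  finally show ?thesis by simp
qed

lemma mem_edges_clique_union:
  "{(i, a), (j, b)} \<in> edges (clique_union n d) \<longleftrightarrow>
    i = j \<and> i < n div (d + 1) \<and> a < d + 1 \<and> b < d + 1 \<and> a \<noteq> b"
  unfolding clique_union_def by (auto simp: doubleton_eq_iff)

lemma finite_edges: "finite_simple_graph G \<Longrightarrow> finite (edges G)"
  by (rule finite_subset [of _ "Pow (verts G)"]) (auto simp: finite_simple_graph_def)

text \<open>Before deletion all vertices of a clique see the same code vertices, so only deleted
  edges can tell them apart.\<close>

lemma inj_on_deleted_code_neighbors:
  assumes "F \<subseteq> edges (clique_union n d)"
    and "separating (delete_edges (clique_union n d) F) C"
    and "C \<subseteq> verts (clique_union n d)"
    and "i < n div (d + 1)"
  shows "inj_on (\<lambda>v. {c \<in> C. {c, v} \<in> F}) ({i} \<times> {..<d + 1})"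
proof (rule inj_onI, rule ccontr)
  let ?G = "delete_edges (clique_union n d) F"
  fix u v
  assume u: "u \<in> {i} \<times> {..<d + 1}" and v: "v \<in> {i} \<times> {..<d + 1}" and "u \<noteq> v"
    and eq: "{c \<in> C. {c, u} \<in> F} = {c \<in> C. {c, v} \<in> F}"
  \<comment> \<open>The case \<open>c = w\<close> fits the same formula: \<open>{w, w}\<close> is a
    singleton, hence no edge and not in \<open>F\<close>, and \<open>w\<close> lies in its own
    closed neighborhood.\<close>
  have nbhd: "closed_neighborhood ?G w \<inter> C = {c \<in> C. fst c = i} - {c \<in> C. {c, w} \<in> F}"
    if w: "w \<in> {i} \<times> {..<d + 1}" for w
  proof -
    have "c \<in> closed_neighborhood ?G w \<longleftrightarrow> fst c = i \<and> {c, w} \<notin> F" if "c \<in> C" for c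
    proof -
      obtain j a b where c: "c = (j, a)" and w': "w = (i, b)"
        using w by (cases c) auto
      have bounds: "j < n div (d + 1)" "a < d + 1" "b < d + 1"
        using \<open>c \<in> C\<close> assms(3) w by (auto simp: c w' clique_union_def)
      have "{c, w} \<in> edges (clique_union n d) \<longleftrightarrow> j = i \<and> a \<noteq> b"
        unfolding c w' mem_edges_clique_union using assms(4) bounds by blast
      moreover have "c \<in> verts (clique_union n d)"
        using \<open>c \<in> C\<close> assms(3) by blast
      ultimately show ?thesis
        using assms(1)
        by (auto simp: closed_neighborhood_def neighborhood_def delete_edges_def c w')
    qed
    then show ?thesis by blast
  qed
  have "u \<in> verts ?G" "v \<in> verts ?G"
    using u v assms(4) by (auto simp: delete_edges_def clique_union_def)
  moreover have "closed_neighborhood ?G u \<inter> C = closed_neighborhood ?G v \<inter> C"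
    by (simp only: nbhd [OF u] nbhd [OF v] eq)
  ultimately show False
    using assms(2) \<open>u \<noteq> v\<close> unfolding separating_def by blast
qed

text \<open>The bound for one clique is summed over all cliques. The parameter \<open>x\<close>
  stays free, to be balanced against the size of the code later.\<close>

lemma card_deleted_edges_ge:
  fixes x :: real
  assumes "d + 1 dvd n" "F \<subseteq> edges (clique_union n d)"
    and "identifying_code (delete_edges (clique_union n d) F) C"
    and "0 < x" "x < 1"
  shows "n * ln (real (d + 1)) - x * real (d + 1) * card C \<le> 2 * ln (1 / x) * card F"
proof -
  define m where "m = n div (d + 1)"
  define A where "A i = {i} \<times> {..<d + 1}" for i :: nat
  define S where "S v = {c \<in> C. {c, v} \<in> F}" for v
  have n: "n = m * (d + 1)"
    unfolding m_def by (rule dvd_div_mult_self [OF assms(1), symmetric])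
  have C_sub: "C \<subseteq> (\<Union>i<m. A i)"
    using assms(3) by (auto simp: identifying_code_def delete_edges_def clique_union_def A_def m_def)
  have fin_C: "finite C"
    using C_sub by (rule finite_subset) (simp add: A_def)
  have fin_F: "finite F"
    using assms(2) finite_edges [OF finite_simple_graph_clique_union] by (rule finite_subset)
  have card_F: "card e = 2" if "e \<in> F" for e
    using that assms(2) finite_simple_graph_clique_union [of n d]
    by (auto simp: finite_simple_graph_def)
  have disj: "A i \<inter> A j = {}" if "i \<noteq> j" for i j
    using that by (auto simp: A_def)
  have clique: "real (d + 1) * (ln (real (d + 1)) - x * card (C \<inter> A i))
      \<le> ln (1 / x) * (\<Sum>v\<in>A i. real (card (S v)))" if "i < m" for i
  proof -
    \<comment> \<open>Every edge in \<open>F\<close> lies inside one clique, so only the code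
      vertices of clique \<open>i\<close> matter.\<close>
    have "S v \<subseteq> C \<inter> A i" if v: "v \<in> A i" for v
    proof
      fix c assume c: "c \<in> S v"
      obtain j a b where "c = (j, a)" "v = (i, b)"
        using v by (cases c) (auto simp: A_def)
      with c have "(j, a) \<in> C" "{(j, a), (i, b)} \<in> edges (clique_union n d)"
        using assms(2) by (auto simp: S_def)
      with \<open>c = (j, a)\<close> show "c \<in> C \<inter> A i"
        by (simp only: mem_edges_clique_union) (simp add: A_def)
    qed
    moreover have "inj_on S (A i)"
      unfolding S_def [abs_def] A_def using assms(2,3) \<open>i < m\<close>
      by (intro inj_on_deleted_code_neighbors)
        (auto simp: identifying_code_def delete_edges_def m_def)
    ultimately have "card (A i) * (ln (card (A i)) - x * card (C \<inter> A i))
        \<le> ln (1 / x) * (\<Sum>v\<in>A i. real (card (S v)))"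
      using fin_C assms(4) by (intro inj_on_subsets_sum_card_ge) (auto simp: A_def)
    moreover have "card (A i) = d + 1" by (simp add: A_def card_cartesian_product)
    ultimately show ?thesis by simp
  qed
  have "(\<Sum>i<m. card (C \<inter> A i)) = card (\<Union>i<m. C \<inter> A i)"
    using fin_C disj by (intro card_UN_disjoint [symmetric]) auto
  also have "(\<Union>i<m. C \<inter> A i) = C"
    using C_sub by blast
  finally have card_C: "(\<Sum>i<m. real (card (C \<inter> A i))) = card C"
    by (metis of_nat_sum)
  have "(\<Sum>i<m. \<Sum>v\<in>A i. card (S v)) = (\<Sum>v\<in>(\<Union>i<m. A i). card (S v))"
    using disj by (intro sum.UNION_disjoint [symmetric]) (auto simp: A_def)
  also have "\<dots> \<le> (\<Sum>v\<in>(\<Union>i<m. A i). card {c. {c, v} \<in> F})"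
  proof (intro sum_mono card_mono)
    fix v
    have "{c. {c, v} \<in> F} \<subseteq> \<Union> F" by auto
    moreover have "finite (\<Union> F)"
      \<comment> \<open>An infinite set has \<open>card\<close> 0, so edges with \<open>card\<close>
        2 are finite.\<close>
      using fin_F card_F by (metis card.infinite finite_Union zero_neq_numeral)
    ultimately show "finite {c. {c, v} \<in> F}" by (rule finite_subset)
  qed (auto simp: S_def)
  also have "\<dots> \<le> 2 * card F"
    using fin_F card_F by (intro sum_card_incident_le) (auto simp: A_def)
  finally have sum_S: "(\<Sum>i<m. \<Sum>v\<in>A i. real (card (S v))) \<le> 2 * card F"
    by (simp flip: of_nat_sum of_nat_le_iff)
  have "n * ln (real (d + 1)) - x * real (d + 1) * card C
      = (\<Sum>i<m. real (d + 1) * (ln (real (d + 1)) - x * card (C \<inter> A i)))"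
    unfolding card_C [symmetric]
    by (simp add: n sum_subtractf sum_distrib_left right_diff_distrib algebra_simps)
  also have "\<dots> \<le> (\<Sum>i<m. ln (1 / x) * (\<Sum>v\<in>A i. real (card (S v))))"
    by (intro sum_mono clique) simp
  also have "\<dots> = ln (1 / x) * (\<Sum>i<m. \<Sum>v\<in>A i. real (card (S v)))"
    by (simp add: sum_distrib_left)
  also have "\<dots> \<le> ln (1 / x) * (2 * card F)"
    \<comment> \<open>Here \<open>x < 1\<close> makes the factor \<open>ln (1 / x)\<close>
      nonnegative.\<close>
    using sum_S assms(4,5) by (intro mult_left_mono) auto
  finally show ?thesis by (simp add: mult_ac)
qed

lemma gamma_ID_attained:
  assumes "admits_identifying_code G"
  obtains C where "identifying_code G C" "card C = gamma_ID G"
proof -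
  have "\<exists>k C. identifying_code G C \<and> card C = k"
    using assms by (auto simp: admits_identifying_code_def)
  then have "\<exists>C. identifying_code G C \<and> card C = gamma_ID G"
    unfolding gamma_ID_def by (rule LeastI_ex)
  then show ?thesis using that by blast
qed

theorem corollary11:
  fixes \<delta> :: "nat \<Rightarrow> nat" and M :: real
  assumes "\<And>n. \<delta> n > 0"
    and "filterlim \<delta> at_top sequentially"
    and "M \<ge> 0"
  shows "\<exists>c::real. c > 0 \<and>
    (\<forall>n. (\<delta> n + 1) dvd n \<longrightarrow>
      (\<forall>F. F \<subseteq> edges (clique_union n (\<delta> n)) \<longrightarrow>
        admits_identifying_code (delete_edges (clique_union n (\<delta> n)) F) \<longrightarrow>
        real (gamma_ID (delete_edges (clique_union n (\<delta> n)) F))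
          \<le> M * (real n * ln (real (\<delta> n)) / real (\<delta> n)) \<longrightarrow>
        real (card F) \<ge> c * real n * ln (real (\<delta> n))))"
proof -
  \<comment> \<open>Then \<open>2 * M * x = M / (2 * M + 1)\<close>, which is below 1/2, and the
    summand 2 keeps \<open>x\<close> at most 1/2 even for \<open>M = 0\<close>.\<close>
  define x where "x = 1 / (4 * M + 2)"
  have x: "0 < x" "x < 1" and Mx: "2 * M * x \<le> 1 / 2"
    using assms(3) by (auto simp: x_def field_simps)
  define L where "L = ln (1 / x)"
  have L: "L > 0"
    using x by (simp add: L_def)
  \<comment> \<open>The code term uses up at most half of \<open>n * ln (\<delta> n)\<close>; the
    other half is at most \<open>2 * L * card F\<close>, whence the constant.\<close>
  have main: "1 / (4 * L) * n * ln (\<delta> n) \<le> card F"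
    if dvd: "\<delta> n + 1 dvd n" and F: "F \<subseteq> edges (clique_union n (\<delta> n))"
      and admits: "admits_identifying_code (delete_edges (clique_union n (\<delta> n)) F)"
      and le: "real (gamma_ID (delete_edges (clique_union n (\<delta> n)) F))
          \<le> M * (real n * ln (real (\<delta> n)) / real (\<delta> n))" for n F
  proof -
    define d where "d = \<delta> n"
    have d: "d > 0" using assms(1) by (simp add: d_def)
    obtain C where C: "identifying_code (delete_edges (clique_union n d) F) C"
      and card_C: "card C = gamma_ID (delete_edges (clique_union n d) F)"
      unfolding d_def by (rule gamma_ID_attained [OF admits])
    define t where "t = n * ln d"
    have t: "t \<ge> 0" using d by (simp add: t_def)
    \<comment> \<open>Replacing \<open>d + 1\<close> by \<open>2 * d\<close> lets the factor cancel
      the denominator \<open>d\<close> in the bound on the code size.\<close>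
    have "(d + 1) * card C \<le> (2 * d) * card C"
      using d by (intro mult_right_mono) auto
    then have "real (d + 1) * card C \<le> real (2 * d) * real (card C)"
      by (metis of_nat_le_iff of_nat_mult)
    also have "\<dots> \<le> real (2 * d) * (M * (t / d))"
      using le card_C by (intro mult_left_mono) (auto simp: t_def d_def)
    also have "\<dots> = 2 * M * t"
      using d by simp
    finally have "x * real (d + 1) * card C \<le> x * (2 * M * t)"
      using x by (simp only: mult.assoc) (intro mult_left_mono, auto)
    also have "\<dots> \<le> 1 / 2 * t"
      using mult_right_mono [OF Mx t] by (simp add: mult_ac)
    finally have "x * real (d + 1) * card C \<le> 1 / 2 * t" .
    moreover have "t \<le> n * ln (real (d + 1))"
      using d by (auto simp: t_def intro!: mult_left_mono)
    moreover have "n * ln (real (d + 1)) - x * real (d + 1) * card C \<le> 2 * L * card F"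
      unfolding L_def using dvd F C x by (intro card_deleted_edges_ge) (auto simp: d_def)
    ultimately have "t \<le> 4 * L * card F" by linarith
    then show ?thesis
      using L by (simp add: t_def d_def field_simps)
  qed
  then show ?thesis
    using L by (intro exI [of _ "1 / (4 * L)"]) auto
qed

end
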